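(* Let $r,r'\in\mathbb{Z}_2$. Then $V(2,r')\otimes P(r)\cong 2V(2,0)\oplus 2V(2,1)$ as $D_4$-modules.
   Context: Let $k$ be an algebraically closed field with $\mathrm{char}(k)\neq 2$. All modules are finite-dimensional left modules; $\otimes=\otimes_k$; $\mathbb{Z}_2=\mathbb{Z}/2\mathbb{Z}$; $nM$ denotes the direct sum of $n$ copies of $M$. $D_4$ is the $k$-algebra generated by $a,b,c,d$ subject to $ba=-ab$, $db=-bd$, $ca=-ac$, $dc=-cd$, $bc=cb$, $a^2=0$, $b^2=1$, $c^2=1$, $d^2=0$, $da+ad=1-bc$. It is a $16$-dimensional Hopf algebra (isomorphic to the Drinfeld double of Sweedler's 4-dimensional Hopf algebra) with comultiplication $\Delta(a)=a\otimes b+1\otimes a$, $\Delta(b)=b\otimes b$, $\Delta(c)=c\otimes c$, $\Delta(d)=d\otimes c+1\otimes d$, counit $\varepsilon(a)=\varepsilon(d)=0$, $\varepsilon(b)=\varepsilon(c)=1$, antipode $S(a)=-ab$, $S(b)=b$, $S(c)=c$, $S(d)=-dc$. Tensor products of $D_4$-modules are $D_4$-modules via $\Delta$. For $r\in\mathbb{Z}_2$: $V(2,r)$ is the simple module with basis $v_1,v_2$ and action $av_1=v_2$, $dv_1=0$, $bv_1=(-1)^rv_1$, $cv_1=(-1)^{r+1}v_1$, $av_2=0$, $dv_2=2v_1$, $bv_2=(-1)^{r+1}v_2$, $cv_2=(-1)^rv_2$. $P(r)$ is the projective cover of the one-dimensional simple module $V(r)$ on which $a,d$ act as $0$ and $b,c$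 act as $(-1)^r$; explicitly, $P(r)$ has a basis $v_1,v_2,v_3,v_4$ with $av_1=v_2$, $dv_1=v_3$, $av_2=0$, $dv_2=-v_4$, $av_3=v_4$, $dv_3=0$, $av_4=dv_4=0$, where $b$ and $c$ both act as $(-1)^r$ on $v_1,v_4$ and as $(-1)^{r+1}$ on $v_2,v_3$. *)

theory Defs
  imports
    "HOL-Analysis.Cartesian_Space"
    "HOL-Library.Poly_Mapping"
    "HOL-Library.Product_Plus"
    "HOL-Library.Z2"
    "HOL-Computational_Algebra.Polynomial"
begin

section \<open>Monoid algebras and two-sided ideals\<close>

inductive_set ideal_gen :: "'r::ring_1 set \<Rightarrow> 'r set" for S where
  zero: "0 \<in> ideal_gen S"
| gen: "s \<in> S \<Longrightarrow> s \<in> ideal_gen S"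
| add: "x \<in> ideal_gen S \<Longrightarrow> y \<in> ideal_gen S \<Longrightarrow> x + y \<in> ideal_gen S"
| mult_left: "x \<in> ideal_gen S \<Longrightarrow> r * x \<in> ideal_gen S"
| mult_right: "x \<in> ideal_gen S \<Longrightarrow> x * r \<in> ideal_gen S"

lemma ideal_gen_uminus: "x \<in> ideal_gen S \<Longrightarrow> - x \<in> ideal_gen S"
  using ideal_gen.mult_left[of x S "-1"] by simp

lemma ideal_gen_diff: "x \<in> ideal_gen S \<Longrightarrow> y \<in> ideal_gen S \<Longrightarrow> x - y \<in> ideal_gen S"
  using ideal_gen.add[OF _ ideal_gen_uminus] by fastforce

lemma ideal_gen_equivp: "equivp (\<lambda>x y. x - y \<in> ideal_gen S)"
proof (rule equivpI)
  show "reflp (\<lambda>x y. x - y \<in> ideal_gen S)"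
    by (simp add: reflp_def ideal_gen.zero)
  show "symp (\<lambda>x y. x - y \<in> ideal_gen S)"
    by (metis (no_types, lifting) ideal_gen_uminus minus_diff_eq sympI)
  show "transp (\<lambda>x y. x - y \<in> ideal_gen S)"
  proof (rule transpI)
    fix x y z assume "x - y \<in> ideal_gen S" "y - z \<in> ideal_gen S"
    from ideal_gen.add[OF this] show "x - z \<in> ideal_gen S" by simp
  qed
qed

lemma ideal_gen_cong_eq: "x = y \<Longrightarrow> x - y \<in> ideal_gen S"
  by (simp add: ideal_gen.zero)

lemma ideal_gen_cong_add:
  "x - y \<in> ideal_gen S \<Longrightarrow> x' - y' \<in> ideal_gen S \<Longrightarrow> (x + x') - (y + y') \<in> ideal_gen S"
  using ideal_gen.add[of "x - y" S "x' - y'"] by (simp add: algebra_simps)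

lemma ideal_gen_cong_diff:
  "x - y \<in> ideal_gen S \<Longrightarrow> x' - y' \<in> ideal_gen S \<Longrightarrow> (x - x') - (y - y') \<in> ideal_gen S"
  using ideal_gen_diff[of "x - y" S "x' - y'"] by (simp add: algebra_simps)

lemma ideal_gen_cong_uminus:
  "x - y \<in> ideal_gen S \<Longrightarrow> (- x) - (- y) \<in> ideal_gen S"
  using ideal_gen_uminus[of "x - y" S] by simp

lemma ideal_gen_cong_mult:
  assumes "x - y \<in> ideal_gen S" "x' - y' \<in> ideal_gen S"
  shows "(x * x') - (y * y') \<in> ideal_gen S"
proof -
  have "(x - y) * x' + y * (x' - y') \<in> ideal_gen S"
    using assms by (intro ideal_gen.add ideal_gen.mult_left ideal_gen.mult_right)
  then show ?thesis by (simp add: algebra_simps)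
qed

lemma poly_mapping_add_induct [case_names single add]:
  fixes p :: "'w \<Rightarrow>\<^sub>0 'k::ab_group_add"
  assumes single: "\<And>w c. P (Poly_Mapping.single w c)"
    and add: "\<And>p q. P p \<Longrightarrow> P q \<Longrightarrow> P (p + q)"
  shows "P p"
proof -
  have P0: "P 0" using single[of undefined 0] by simp
  have "P (\<Sum>w\<in>A. Poly_Mapping.single w (Poly_Mapping.lookup p w))" if "finite A" for A
    using that by induction (auto intro: P0 single add)
  moreover have "(\<Sum>w\<in>Poly_Mapping.keys p. Poly_Mapping.single w (Poly_Mapping.lookup p w)) = p"
    by (rule poly_mapping_eqI)
      (auto simp: lookup_sum lookup_single when_def sum.delta in_keys_iff)
  ultimately show ?thesis by (metis finite_keys)
qed

text \<open>
  A unital associative \<open>k\<close>-algebra is given by its multiplication \<open>mul\<close> and the central ring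
  homomorphism \<open>sc\<close> embedding the scalars.  The map \<open>monoid_alg_ev mul sc h\<close> is the linear
  extension of \<open>h\<close> to formal linear combinations.
\<close>

definition monoid_alg_ev ::
  "('r::ab_group_add \<Rightarrow> 'r \<Rightarrow> 'r) \<Rightarrow> ('k::field \<Rightarrow> 'r) \<Rightarrow> ('w \<Rightarrow> 'r) \<Rightarrow> ('w \<Rightarrow>\<^sub>0 'k) \<Rightarrow> 'r" where
  "monoid_alg_ev mul sc h p =
     (\<Sum>w\<in>Poly_Mapping.keys p. mul (sc (Poly_Mapping.lookup p w)) (h w))"

definition word_ev ::
  "('r \<Rightarrow> 'r \<Rightarrow> 'r) \<Rightarrow> ('k::field \<Rightarrow> 'r) \<Rightarrow> ('g \<Rightarrow> 'r) \<Rightarrow> 'g list \<Rightarrow> 'r" where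
  "word_ev mul sc f w = foldr (\<lambda>g x. mul (f g) x) w (sc 1)"

locale scalar_algebra =
  fixes mul :: "'r::ab_group_add \<Rightarrow> 'r \<Rightarrow> 'r" and sc :: "'k::field \<Rightarrow> 'r"
  assumes assoc: "mul (mul x y) z = mul x (mul y z)"
    and one_left: "mul (sc 1) x = x"
    and one_right: "mul x (sc 1) = x"
    and distrib_left: "mul x (y + z) = mul x y + mul x z"
    and distrib_right: "mul (y + z) x = mul y x + mul z x"
    and sc_add: "sc (c + d) = sc c + sc d"
    and sc_mult: "sc (c * d) = mul (sc c) (sc d)"
    and sc_central: "mul (sc c) x = mul x (sc c)"
begin

lemma mul_zero_left: "mul 0 x = 0"
  using distrib_right[of 0 0 x] by simp

lemma mul_zero_right: "mul x 0 = 0"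
  using distrib_left[of x 0 0] by simp

lemma sc_zero: "sc 0 = 0"
  using sc_add[of 0 0] by simp

lemma sc_uminus: "sc (- c) = - sc c"
  using sc_add[of c "- c"] by (simp add: sc_zero eq_neg_iff_add_eq_0 add.commute)

lemma mul_minus_left: "mul (- x) y = - mul x y"
  using distrib_right[of x "- x" y] by (simp add: mul_zero_left eq_neg_iff_add_eq_0 add.commute)

abbreviation "ev \<equiv> monoid_alg_ev mul sc"

lemma ev_superset:
  assumes "finite A" "Poly_Mapping.keys p \<subseteq> A"
  shows "ev h p = (\<Sum>w\<in>A. mul (sc (Poly_Mapping.lookup p w)) (h w))"
  unfolding monoid_alg_ev_def
  by (rule sum.mono_neutral_left)
    (use assms in \<open>auto simp: in_keys_iff sc_zero mul_zero_left\<close>)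

lemma ev_single: "ev h (Poly_Mapping.single w c) = mul (sc c) (h w)"
  by (subst ev_superset[of "{w}"]) auto

lemma ev_zero: "ev h 0 = 0"
  by (simp add: monoid_alg_ev_def)

lemma ev_add: "ev h (p + q) = ev h p + ev h q"
proof -
  let ?A = "Poly_Mapping.keys p \<union> Poly_Mapping.keys q"
  have "ev h p = (\<Sum>w\<in>?A. mul (sc (Poly_Mapping.lookup p w)) (h w))"
    by (rule ev_superset) auto
  moreover have "ev h q = (\<Sum>w\<in>?A. mul (sc (Poly_Mapping.lookup q w)) (h w))"
    by (rule ev_superset) auto
  moreover have "ev h (p + q) = (\<Sum>w\<in>?A. mul (sc (Poly_Mapping.lookup (p + q) w)) (h w))"
    by (rule ev_superset) (auto simp: keys_add)
  ultimately show ?thesis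
    by (simp add: lookup_add sc_add distrib_right sum.distrib)
qed

lemma ev_uminus: "ev h (- p) = - ev h p"
  using ev_add[of h p "- p"] by (simp add: ev_zero eq_neg_iff_add_eq_0 add.commute)

lemma ev_diff: "ev h (p - q) = ev h p - ev h q"
  using ev_add[of h p "- q"] by (simp add: ev_uminus)

lemma ev_mult:
  assumes h: "\<And>u v. h (u + v) = mul (h u) (h v)"
  shows "ev h (p * q) = mul (ev h p) (ev h q)"
proof (induction p rule: poly_mapping_add_induct)
  case (single u c)
  show ?case
  proof (induction q rule: poly_mapping_add_induct)
    case (single v d)
    have "mul (sc (c * d)) (h (u + v)) = mul (mul (sc c) (h u)) (mul (sc d) (h v))"
      by (metis assoc h sc_mult sc_central)
    then show ?case by (simp add: mult_single ev_single)
  qed (simp add: ring_distribs ev_add distrib_left)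
qed (simp add: ring_distribs ev_add distrib_right)

lemma ev_one: "h 0 = sc 1 \<Longrightarrow> ev h 1 = sc 1"
  unfolding single_one[symmetric] ev_single by (simp add: one_left)

lemma ev_scalar: "h 0 = sc 1 \<Longrightarrow> ev h (Poly_Mapping.single 0 c) = sc c"
  by (simp add: ev_single one_right)

lemma ev_ideal:
  assumes h: "\<And>u v. h (u + v) = mul (h u) (h v)"
    and S: "\<And>s. s \<in> S \<Longrightarrow> ev h s = 0"
    and p: "p \<in> ideal_gen S"
  shows "ev h p = 0"
  using p by induction (auto simp: S ev_zero ev_add ev_mult[OF h] mul_zero_left mul_zero_right)

lemma ev_cong:
  assumes "\<And>u v. h (u + v) = mul (h u) (h v)"
    and "\<And>s. s \<in> S \<Longrightarrow> ev h s = 0"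
    and "p - q \<in> ideal_gen S"
  shows "ev h p = ev h q"
  using ev_ideal[OF assms] by (simp add: ev_diff)

end

text \<open>Words form the free monoid, so \<open>d4_letter list \<Rightarrow>\<^sub>0 'k\<close> below is the free algebra
  \<open>k\<langle>a,b,c,d\<rangle>\<close>.\<close>

instantiation list :: (type) monoid_add
begin
definition zero_list_def: "0 = []"
definition plus_list_def: "xs + ys = xs @ ys"
instance by standard (simp_all add: zero_list_def plus_list_def)
end

context scalar_algebra
begin

lemma word_ev_zero: "word_ev mul sc f 0 = sc 1"
  by (simp add: word_ev_def zero_list_def)

lemma word_ev_plus: "word_ev mul sc f (u + v) = mul (word_ev mul sc f u) (word_ev mul sc f v)"
  unfolding word_ev_def plus_list_def by (induction u) (simp_all add: one_left assoc)

lemma ev_word_mult: "ev (word_ev mul sc f) (p * q) = mul (ev (word_ev mul sc f) p) (ev (word_ev mul sc f) q)"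
  by (rule ev_mult) (rule word_ev_plus)

lemma ev_word_scalar: "ev (word_ev mul sc f) (Poly_Mapping.single 0 c) = sc c"
  by (rule ev_scalar) (rule word_ev_zero)

lemma ev_word_one: "ev (word_ev mul sc f) 1 = sc 1"
  by (rule ev_one) (rule word_ev_zero)

lemma ev_word_letter: "ev (word_ev mul sc f) (Poly_Mapping.single [g] 1) = f g"
  by (simp add: ev_single word_ev_def one_left one_right)

end


section \<open>The algebra \<open>D\<^sub>4\<close>\<close>

datatype d4_letter = Ga | Gb | Gc | Gd

definition free_gen :: "d4_letter \<Rightarrow> (d4_letter list \<Rightarrow>\<^sub>0 'k::field)" where
  "free_gen g = Poly_Mapping.single [g] 1"

definition d4_relations :: "(d4_letter list \<Rightarrow>\<^sub>0 'k::field) set" where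
  "d4_relations = (let a = free_gen Ga; b = free_gen Gb; c = free_gen Gc; d = free_gen Gd in
     {b * a - (- (a * b)), d * b - (- (b * d)), c * a - (- (a * c)), d * c - (- (c * d)),
      b * c - c * b, a ^ 2 - 0, b ^ 2 - 1, c ^ 2 - 1, d ^ 2 - 0, (d * a + a * d) - (1 - b * c)})"

quotient_type (overloaded) 'k d4 =
  "d4_letter list \<Rightarrow>\<^sub>0 'k::field" / "\<lambda>x y. x - y \<in> ideal_gen d4_relations"
  by (rule ideal_gen_equivp)

text \<open>The images of the four generators satisfy the relations of \<open>D\<^sub>4\<close> in an algebra \<open>(mul, sc)\<close>.\<close>

definition d4_gens_ok ::
  "('r::ab_group_add \<Rightarrow> 'r \<Rightarrow> 'r) \<Rightarrow> ('k::field \<Rightarrow> 'r) \<Rightarrow> (d4_letter \<Rightarrow> 'r) \<Rightarrow> bool" where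
  "d4_gens_ok mul sc f \<longleftrightarrow>
     mul (f Gb) (f Ga) = - mul (f Ga) (f Gb) \<and> mul (f Gd) (f Gb) = - mul (f Gb) (f Gd) \<and>
     mul (f Gc) (f Ga) = - mul (f Ga) (f Gc) \<and> mul (f Gd) (f Gc) = - mul (f Gc) (f Gd) \<and>
     mul (f Gb) (f Gc) = mul (f Gc) (f Gb) \<and>
     mul (f Ga) (f Ga) = 0 \<and> mul (f Gb) (f Gb) = sc 1 \<and>
     mul (f Gc) (f Gc) = sc 1 \<and> mul (f Gd) (f Gd) = 0 \<and>
     mul (f Gd) (f Ga) + mul (f Ga) (f Gd) = sc 1 - mul (f Gb) (f Gc)"

lemma (in scalar_algebra) ev_d4_relations:
  assumes "d4_gens_ok mul sc f" "s \<in> d4_relations"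
  shows "ev (word_ev mul sc f) s = 0"
  using assms unfolding d4_relations_def Let_def d4_gens_ok_def free_gen_def
  by (auto simp: ev_diff ev_add ev_uminus ev_zero ev_word_mult ev_word_one ev_word_letter
      power2_eq_square)

lemma (in scalar_algebra) d4_ev_cong:
  assumes "d4_gens_ok mul sc f" "p - q \<in> ideal_gen d4_relations"
  shows "ev (word_ev mul sc f) p = ev (word_ev mul sc f) q"
  by (rule ev_cong[OF _ _ assms(2)]) (auto simp: word_ev_plus ev_d4_relations[OF assms(1)])

interpretation field_alg: scalar_algebra "(*) :: 'k::field \<Rightarrow> 'k \<Rightarrow> 'k" "\<lambda>c. c"
  by standard (simp_all add: algebra_simps)

definition counit_gen :: "d4_letter \<Rightarrow> 'k::field" where
  "counit_gen g = (case g of Ga \<Rightarrow> 0 | Gb \<Rightarrow> 1 | Gc \<Rightarrow> 1 | Gd \<Rightarrow> 0)"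

lemma counit_gens_ok: "d4_gens_ok (*) (\<lambda>c::'k::field. c) counit_gen"
  by (simp add: d4_gens_ok_def counit_gen_def)

lift_definition d4_counit :: "'k::field d4 \<Rightarrow> 'k" is
  "monoid_alg_ev (*) (\<lambda>c. c) (word_ev (*) (\<lambda>c. c) counit_gen)"
  by (rule field_alg.d4_ev_cong[OF counit_gens_ok])

instantiation d4 :: (field) ring_1
begin
lift_definition zero_d4 :: "'a d4" is 0 .
lift_definition one_d4 :: "'a d4" is 1 .
lift_definition plus_d4 :: "'a d4 \<Rightarrow> 'a d4 \<Rightarrow> 'a d4" is "(+)"
  by (rule ideal_gen_cong_add)
lift_definition minus_d4 :: "'a d4 \<Rightarrow> 'a d4 \<Rightarrow> 'a d4" is "(-)"
  by (rule ideal_gen_cong_diff)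
lift_definition uminus_d4 :: "'a d4 \<Rightarrow> 'a d4" is uminus
  by (rule ideal_gen_cong_uminus)
lift_definition times_d4 :: "'a d4 \<Rightarrow> 'a d4 \<Rightarrow> 'a d4" is "(*)"
  by (rule ideal_gen_cong_mult)
instance
proof
  show "(0::'a d4) \<noteq> 1"
  proof
    assume "(0::'a d4) = 1"
    then have "d4_counit (0::'a d4) = d4_counit 1" by simp
    then show False
      by transfer (simp add: field_alg.ev_zero field_alg.ev_word_one)
  qed
qed (transfer, rule ideal_gen_cong_eq, simp add: algebra_simps)+
end

lift_definition d4_scalar :: "'k::field \<Rightarrow> 'k d4" is "Poly_Mapping.single 0" .

lift_definition d4_gen :: "d4_letter \<Rightarrow> 'k::field d4" is free_gen .

abbreviation d4_a :: "'k::field d4" where "d4_a \<equiv> d4_gen Ga"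
abbreviation d4_b :: "'k::field d4" where "d4_b \<equiv> d4_gen Gb"
abbreviation d4_c :: "'k::field d4" where "d4_c \<equiv> d4_gen Gc"
abbreviation d4_d :: "'k::field d4" where "d4_d \<equiv> d4_gen Gd"

lemma single_zero_commute:
  "Poly_Mapping.single 0 c * p = p * Poly_Mapping.single 0 (c::'k::field)"
  by (induction p rule: poly_mapping_add_induct) (simp_all add: mult_single algebra_simps)

interpretation d4_alg: scalar_algebra "(*) :: 'k::field d4 \<Rightarrow> 'k d4 \<Rightarrow> 'k d4" d4_scalar
proof
  show one: "d4_scalar 1 * x = x" for x :: "'k d4"
    by transfer (simp add: ideal_gen.zero)
  show "x * d4_scalar 1 = x" for x :: "'k d4"
    by transfer (simp add: ideal_gen.zero)
  show "d4_scalar (c + d) = d4_scalar c + d4_scalar d" for c d :: 'k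
    by transfer (rule ideal_gen_cong_eq, simp add: single_add)
  show "d4_scalar (c * d) = d4_scalar c * d4_scalar d" for c d :: 'k
    by transfer (rule ideal_gen_cong_eq, simp add: mult_single)
  show "d4_scalar c * x = x * d4_scalar c" for c and x :: "'k d4"
    by transfer (rule ideal_gen_cong_eq, rule single_zero_commute)
qed (simp_all add: algebra_simps)

lemma d4_scalar_one [simp]: "d4_scalar 1 = 1"
  by transfer (simp add: ideal_gen.zero)

lemma d4_relations_hold:
  shows "d4_b * d4_a = - (d4_a * (d4_b :: 'k::field d4))"
    and "d4_d * d4_b = - (d4_b * (d4_d :: 'k d4))"
    and "d4_c * d4_a = - (d4_a * (d4_c :: 'k d4))"
    and "d4_d * d4_c = - (d4_c * (d4_d :: 'k d4))"
    and "d4_b * d4_c = d4_c * (d4_b :: 'k d4)"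
    and "d4_a ^ 2 = (0 :: 'k d4)"
    and "d4_b ^ 2 = (1 :: 'k d4)"
    and "d4_c ^ 2 = (1 :: 'k d4)"
    and "d4_d ^ 2 = (0 :: 'k d4)"
    and "d4_d * d4_a + d4_a * d4_d = 1 - d4_b * (d4_c :: 'k d4)"
  unfolding power2_eq_square
  by (transfer, rule ideal_gen.gen,
      simp add: d4_relations_def Let_def power2_eq_square)+

text \<open>The map out of \<open>D\<^sub>4\<close> determined by the images \<open>f\<close> of the generators; it is a well-defined
  algebra homomorphism when these satisfy the relations (see \<open>d4_lift_hom\<close>).\<close>

definition d4_lift ::
  "('r::ab_group_add \<Rightarrow> 'r \<Rightarrow> 'r) \<Rightarrow> ('k::field \<Rightarrow> 'r) \<Rightarrow> (d4_letter \<Rightarrow> 'r) \<Rightarrow> 'k d4 \<Rightarrow> 'r" where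
  "d4_lift mul sc f x = monoid_alg_ev mul sc (word_ev mul sc f) (rep_d4 x)"

lemma (in scalar_algebra) d4_lift_abs:
  assumes "d4_gens_ok mul sc f"
  shows "d4_lift mul sc f (abs_d4 p) = ev (word_ev mul sc f) p"
proof -
  have "rep_d4 (abs_d4 p) - p \<in> ideal_gen d4_relations"
    unfolding d4.abs_eq_iff[symmetric] by (rule Quotient3_abs_rep[OF Quotient3_d4])
  then show ?thesis
    unfolding d4_lift_def by (rule d4_ev_cong[OF assms])
qed

lemma (in scalar_algebra) d4_lift_hom:
  assumes ok: "d4_gens_ok mul sc f"
  shows "d4_lift mul sc f (x + y) = d4_lift mul sc f x + d4_lift mul sc f y"
    and "d4_lift mul sc f (x * y) = mul (d4_lift mul sc f x) (d4_lift mul sc f y)"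
    and "d4_lift mul sc f (d4_scalar c) = sc c"
    and "d4_lift mul sc f (d4_gen g) = f g"
proof -
  obtain p q where [simp]: "x = abs_d4 p" "y = abs_d4 q"
    by (rule that[of "rep_d4 x" "rep_d4 y"]) (simp_all only: Quotient3_abs_rep[OF Quotient3_d4])
  show "d4_lift mul sc f (x + y) = d4_lift mul sc f x + d4_lift mul sc f y"
    by (simp add: plus_d4.abs_eq d4_lift_abs[OF ok] ev_add)
  show "d4_lift mul sc f (x * y) = mul (d4_lift mul sc f x) (d4_lift mul sc f y)"
    by (simp add: times_d4.abs_eq d4_lift_abs[OF ok] ev_word_mult)
  show "d4_lift mul sc f (d4_scalar c) = sc c"
    by (simp add: d4_scalar.abs_eq d4_lift_abs[OF ok] ev_word_scalar)
  show "d4_lift mul sc f (d4_gen g) = f g"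
    by (simp add: d4_gen.abs_eq free_gen_def d4_lift_abs[OF ok] ev_word_letter)
qed


lemma d4_induct [case_names scalar gen add mult]:
  fixes x :: "'k::field d4"
  assumes scalar: "\<And>s. Q (d4_scalar s)"
    and gen: "\<And>g. Q (d4_gen g)"
    and add: "\<And>x y. Q x \<Longrightarrow> Q y \<Longrightarrow> Q (x + y)"
    and mult: "\<And>x y. Q x \<Longrightarrow> Q y \<Longrightarrow> Q (x * y)"
  shows "Q x"
proof -
  have word: "Q (abs_d4 (Poly_Mapping.single w 1))" for w
  proof (induction w)
    case Nil
    show ?case using scalar[of 1] by (simp add: d4_scalar.abs_eq zero_list_def)
  next
    case (Cons g w)
    have "Poly_Mapping.single (g # w) (1::'k) = free_gen g * Poly_Mapping.single w 1"
      by (simp add: free_gen_def mult_single plus_list_def)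
    then show ?case
      using mult[OF gen[of g] Cons] by (simp add: d4_gen.abs_eq times_d4.abs_eq)
  qed
  have "Q (abs_d4 p)" for p
  proof (induction p rule: poly_mapping_add_induct)
    case (single w c)
    have "Poly_Mapping.single w c = Poly_Mapping.single 0 c * Poly_Mapping.single w (1::'k)"
      by (simp add: mult_single)
    then show ?case
      using mult[OF scalar[of c] word[of w]] by (simp add: d4_scalar.abs_eq times_d4.abs_eq)
  next
    case (add p q)
    then show ?case using assms(3) by (simp flip: plus_d4.abs_eq)
  qed
  from this[of "rep_d4 x"] show ?thesis
    by (simp only: Quotient3_abs_rep[OF Quotient3_d4])
qed


section \<open>The tensor square \<open>D\<^sub>4 \<otimes> D\<^sub>4\<close> and the comultiplication\<close>

text \<open>A copy of the multiplicative monoid of a ring, written additively because monoid algebras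
  are built on additive monoids.\<close>

datatype 'a mul_monoid = Mul (unMul: 'a)

instantiation mul_monoid :: (monoid_mult) monoid_add
begin
definition zero_mul_monoid_def: "0 = Mul 1"
definition plus_mul_monoid_def: "x + y = Mul (unMul x * unMul y)"
instance
  by standard (simp_all add: zero_mul_monoid_def plus_mul_monoid_def mult.assoc)
end

text \<open>Formal linear combinations of pairs \<open>(x, y)\<close>, multiplied by
  \<open>(x, y) (x', y') = (x x', y y')\<close>, modulo bilinearity.  The span of the bilinearity relations is
  already a two-sided ideal, so the quotient is the usual tensor product of vector spaces with
  its usual algebra structure.\<close>

type_synonym 'k d4_pairs = "('k d4 mul_monoid \<times> 'k d4 mul_monoid) \<Rightarrow>\<^sub>0 'k"

definition pair_sym :: "'k::field d4 \<Rightarrow> 'k d4 \<Rightarrow> 'k d4_pairs" where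
  "pair_sym x y = Poly_Mapping.single (Mul x, Mul y) 1"

definition bilinear_relations :: "'k::field d4_pairs set" where
  "bilinear_relations =
     {pair_sym (x + x') y - (pair_sym x y + pair_sym x' y) | x x' y. True} \<union>
     {pair_sym x (y + y') - (pair_sym x y + pair_sym x y') | x y y'. True} \<union>
     {pair_sym (d4_scalar s * x) y - Poly_Mapping.single 0 s * pair_sym x y | s x y. True} \<union>
     {pair_sym x (d4_scalar s * y) - Poly_Mapping.single 0 s * pair_sym x y | s x y. True}"

quotient_type (overloaded) 'k d4_sq =
  "'k::field d4_pairs" / "\<lambda>x y. x - y \<in> ideal_gen bilinear_relations"
  by (rule ideal_gen_equivp)

definition pair_ev :: "('k::field d4 \<Rightarrow> 'k d4 \<Rightarrow> 'r) \<Rightarrow> 'k d4 mul_monoid \<times> 'k d4 mul_monoid \<Rightarrow> 'r" where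
  "pair_ev h w = h (unMul (fst w)) (unMul (snd w))"

locale bilinear_hom = scalar_algebra mul sc
  for mul :: "'r::ab_group_add \<Rightarrow> 'r \<Rightarrow> 'r" and sc :: "'k::field \<Rightarrow> 'r" +
  fixes h :: "'k d4 \<Rightarrow> 'k d4 \<Rightarrow> 'r"
  assumes h_one: "h 1 1 = sc 1"
    and h_mult: "h (x * x') (y * y') = mul (h x y) (h x' y')"
    and h_add_left: "h (x + x') y = h x y + h x' y"
    and h_add_right: "h x (y + y') = h x y + h x y'"
    and h_scale_left: "h (d4_scalar s * x) y = mul (sc s) (h x y)"
    and h_scale_right: "h x (d4_scalar s * y) = mul (sc s) (h x y)"
begin

lemma pair_ev_zero: "pair_ev h 0 = sc 1"
  by (simp add: pair_ev_def zero_prod_def zero_mul_monoid_def h_one)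

lemma pair_ev_plus: "pair_ev h (u + v) = mul (pair_ev h u) (pair_ev h v)"
  by (simp add: pair_ev_def plus_prod_def plus_mul_monoid_def h_mult)

lemma ev_pair_mult: "ev (pair_ev h) (p * q) = mul (ev (pair_ev h) p) (ev (pair_ev h) q)"
  by (rule ev_mult) (rule pair_ev_plus)

lemma ev_pair_scalar: "ev (pair_ev h) (Poly_Mapping.single 0 c) = sc c"
  by (rule ev_scalar) (rule pair_ev_zero)

lemma ev_pair_one: "ev (pair_ev h) 1 = sc 1"
  by (rule ev_one) (rule pair_ev_zero)

lemma ev_pair_sym: "ev (pair_ev h) (pair_sym x y) = h x y"
  by (simp add: pair_sym_def ev_single pair_ev_def one_left)

lemma ev_bilinear_relations:
  assumes "s \<in> bilinear_relations"
  shows "ev (pair_ev h) s = 0"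
  using assms unfolding bilinear_relations_def
  by (auto simp: ev_diff ev_add ev_pair_mult ev_pair_scalar ev_pair_sym
      h_add_left h_add_right h_scale_left h_scale_right)

lemma pair_ev_cong:
  "p - q \<in> ideal_gen bilinear_relations \<Longrightarrow> ev (pair_ev h) p = ev (pair_ev h) q"
  by (rule ev_cong[OF _ ev_bilinear_relations]) (auto simp: pair_ev_plus)

end

lemma d4_counit_hom:
  shows "d4_counit (x + y) = d4_counit x + d4_counit (y :: 'k::field d4)"
    and "d4_counit (x * y) = d4_counit x * d4_counit y"
    and "d4_counit (d4_scalar s :: 'k d4) = s"
    and "d4_counit (1 :: 'k d4) = 1"
    and "d4_counit (d4_gen g :: 'k d4) = counit_gen g"
proof -
  show "d4_counit (x + y) = d4_counit x + d4_counit y"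
    by transfer (rule field_alg.ev_add)
  show "d4_counit (x * y) = d4_counit x * d4_counit y"
    by transfer (rule field_alg.ev_word_mult)
  show s: "d4_counit (d4_scalar s) = s" for s :: 'k
    by transfer (rule field_alg.ev_word_scalar)
  show "d4_counit (1 :: 'k d4) = 1"
    using s[of 1] by simp
  show "d4_counit (d4_gen g :: 'k d4) = counit_gen g"
    by transfer (simp add: free_gen_def field_alg.ev_word_letter)
qed

interpretation counit_sq: bilinear_hom "(*)" "\<lambda>c::'k::field. c" "\<lambda>x y. d4_counit x * d4_counit y"
  by standard (simp_all add: d4_counit_hom algebra_simps)

lift_definition d4_sq_counit :: "'k::field d4_sq \<Rightarrow> 'k" is
  "monoid_alg_ev (*) (\<lambda>c. c) (pair_ev (\<lambda>x y. d4_counit x * d4_counit y))"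
  by (rule counit_sq.pair_ev_cong)

instantiation d4_sq :: (field) ring_1
begin
lift_definition zero_d4_sq :: "'a d4_sq" is 0 .
lift_definition one_d4_sq :: "'a d4_sq" is 1 .
lift_definition plus_d4_sq :: "'a d4_sq \<Rightarrow> 'a d4_sq \<Rightarrow> 'a d4_sq" is "(+)"
  by (rule ideal_gen_cong_add)
lift_definition minus_d4_sq :: "'a d4_sq \<Rightarrow> 'a d4_sq \<Rightarrow> 'a d4_sq" is "(-)"
  by (rule ideal_gen_cong_diff)
lift_definition uminus_d4_sq :: "'a d4_sq \<Rightarrow> 'a d4_sq" is uminus
  by (rule ideal_gen_cong_uminus)
lift_definition times_d4_sq :: "'a d4_sq \<Rightarrow> 'a d4_sq \<Rightarrow> 'a d4_sq" is "(*)"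
  by (rule ideal_gen_cong_mult)
instance
proof
  show "(0::'a d4_sq) \<noteq> 1"
  proof
    assume "(0::'a d4_sq) = 1"
    then have "d4_sq_counit (0::'a d4_sq) = d4_sq_counit 1" by simp
    then show False
      by transfer (simp add: field_alg.ev_zero counit_sq.ev_pair_one)
  qed
qed (transfer, rule ideal_gen_cong_eq, simp add: algebra_simps)+
end

lift_definition d4_sq_scalar :: "'k::field \<Rightarrow> 'k d4_sq" is "Poly_Mapping.single 0" .

definition d4_tensor :: "'k::field d4 \<Rightarrow> 'k d4 \<Rightarrow> 'k d4_sq"  (infixl "\<otimes>\<^sub>D" 75) where
  "x \<otimes>\<^sub>D y = abs_d4_sq (pair_sym x y)"

interpretation d4_sq_alg: scalar_algebra "(*) :: 'k::field d4_sq \<Rightarrow> 'k d4_sq \<Rightarrow> 'k d4_sq" d4_sq_scalar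
proof
  show "d4_sq_scalar 1 * x = x" for x :: "'k d4_sq"
    by transfer (simp add: ideal_gen.zero)
  show "x * d4_sq_scalar 1 = x" for x :: "'k d4_sq"
    by transfer (simp add: ideal_gen.zero)
  show "d4_sq_scalar (c + d) = d4_sq_scalar c + d4_sq_scalar d" for c d :: 'k
    by transfer (rule ideal_gen_cong_eq, simp add: single_add)
  show "d4_sq_scalar (c * d) = d4_sq_scalar c * d4_sq_scalar d" for c d :: 'k
    by transfer (rule ideal_gen_cong_eq, simp add: mult_single)
  show "d4_sq_scalar c * x = x * d4_sq_scalar c" for c and x :: "'k d4_sq"
    by transfer (rule ideal_gen_cong_eq, rule single_zero_commute)
qed (simp_all add: algebra_simps)

lemma d4_sq_scalar_one [simp]: "d4_sq_scalar 1 = 1"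
  by transfer (simp add: ideal_gen.zero)

lemma d4_tensor_bilinear:
  shows "(x + x') \<otimes>\<^sub>D y = x \<otimes>\<^sub>D y + x' \<otimes>\<^sub>D (y :: 'k::field d4)"
    and "x \<otimes>\<^sub>D (y + y') = x \<otimes>\<^sub>D y + x \<otimes>\<^sub>D y'"
    and "(d4_scalar s * x) \<otimes>\<^sub>D y = d4_sq_scalar s * (x \<otimes>\<^sub>D y)"
    and "x \<otimes>\<^sub>D (d4_scalar s * y) = d4_sq_scalar s * (x \<otimes>\<^sub>D y)"
proof -
  have rel: "abs_d4_sq p = abs_d4_sq q" if "p - q \<in> bilinear_relations" for p q :: "'k d4_pairs"
    unfolding d4_sq.abs_eq_iff using that by (rule ideal_gen.gen)
  note defs = d4_tensor_def d4_sq_scalar.abs_eq plus_d4_sq.abs_eq times_d4_sq.abs_eq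
  show "(x + x') \<otimes>\<^sub>D y = x \<otimes>\<^sub>D y + x' \<otimes>\<^sub>D y"
    unfolding defs by (rule rel, unfold bilinear_relations_def) blast
  show "x \<otimes>\<^sub>D (y + y') = x \<otimes>\<^sub>D y + x \<otimes>\<^sub>D y'"
    unfolding defs by (rule rel, unfold bilinear_relations_def) blast
  show "(d4_scalar s * x) \<otimes>\<^sub>D y = d4_sq_scalar s * (x \<otimes>\<^sub>D y)"
    unfolding defs by (rule rel, unfold bilinear_relations_def) blast
  show "x \<otimes>\<^sub>D (d4_scalar s * y) = d4_sq_scalar s * (x \<otimes>\<^sub>D y)"
    unfolding defs by (rule rel, unfold bilinear_relations_def) blast
qed

lemma d4_tensor_mult: "(x \<otimes>\<^sub>D y) * (x' \<otimes>\<^sub>D y') = (x * x') \<otimes>\<^sub>D (y * (y' :: 'k::field d4))"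
  by (simp add: d4_tensor_def times_d4_sq.abs_eq pair_sym_def mult_single
      plus_prod_def plus_mul_monoid_def)

lemma d4_tensor_one: "1 \<otimes>\<^sub>D 1 = (1 :: 'k::field d4_sq)"
  by (simp add: d4_tensor_def one_d4_sq.abs_eq pair_sym_def flip: single_one
      zero_mul_monoid_def zero_prod_def)

lemma d4_tensor_minus:
  shows "(- x) \<otimes>\<^sub>D y = - (x \<otimes>\<^sub>D (y :: 'k::field d4))"
    and "x \<otimes>\<^sub>D (- y) = - (x \<otimes>\<^sub>D y)"
    and "(x - x') \<otimes>\<^sub>D y = x \<otimes>\<^sub>D y - x' \<otimes>\<^sub>D y"
    and "x \<otimes>\<^sub>D (y - y') = x \<otimes>\<^sub>D y - x \<otimes>\<^sub>D y'"
    and "0 \<otimes>\<^sub>D y = 0" and "x \<otimes>\<^sub>D 0 = 0"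
proof -
  have 1: "(u - v) \<otimes>\<^sub>D y = u \<otimes>\<^sub>D y - v \<otimes>\<^sub>D y" for u v y :: "'k d4"
    using d4_tensor_bilinear(1)[of "u - v" v y] by simp
  have 2: "y \<otimes>\<^sub>D (u - v) = y \<otimes>\<^sub>D u - y \<otimes>\<^sub>D v" for u v y :: "'k d4"
    using d4_tensor_bilinear(2)[of y "u - v" v] by simp
  have 3: "0 \<otimes>\<^sub>D y = 0" "y \<otimes>\<^sub>D 0 = 0" for y :: "'k d4"
    using 1[of 0 0 y] 2[of y 0 0] by simp_all
  show "(- x) \<otimes>\<^sub>D y = - (x \<otimes>\<^sub>D y)" "x \<otimes>\<^sub>D (- y) = - (x \<otimes>\<^sub>D y)"
    using 1[of 0 x y] 2[of x 0 y] by (simp_all add: 3)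
  show "(x - x') \<otimes>\<^sub>D y = x \<otimes>\<^sub>D y - x' \<otimes>\<^sub>D y" "x \<otimes>\<^sub>D (y - y') = x \<otimes>\<^sub>D y - x \<otimes>\<^sub>D y'"
    by (fact 1, fact 2)
  show "0 \<otimes>\<^sub>D y = 0" "x \<otimes>\<^sub>D 0 = 0"
    by (fact 3)+
qed

definition comult_gen :: "d4_letter \<Rightarrow> 'k::field d4_sq" where
  "comult_gen g = (case g of
      Ga \<Rightarrow> d4_a \<otimes>\<^sub>D d4_b + 1 \<otimes>\<^sub>D d4_a
    | Gb \<Rightarrow> d4_b \<otimes>\<^sub>D d4_b
    | Gc \<Rightarrow> d4_c \<otimes>\<^sub>D d4_c
    | Gd \<Rightarrow> d4_d \<otimes>\<^sub>D d4_c + 1 \<otimes>\<^sub>D d4_d)"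

definition d4_comult :: "'k::field d4 \<Rightarrow> 'k d4_sq" where
  "d4_comult = d4_lift (*) d4_sq_scalar comult_gen"

lemma comult_gens_ok: "d4_gens_ok (*) (d4_sq_scalar :: 'k::field \<Rightarrow> _) comult_gen"
proof -
  note r = d4_relations_hold[where 'k='k, unfolded power2_eq_square]
  have da: "d4_d * d4_a = 1 - d4_b * d4_c - d4_a * (d4_d :: 'k d4)"
    using r(10) by (simp add: algebra_simps)
  show ?thesis
    unfolding d4_gens_ok_def comult_gen_def
    by (simp add: ring_distribs d4_tensor_mult d4_tensor_minus d4_tensor_one r(1-9) da)
qed

lemmas d4_comult_hom = d4_sq_alg.d4_lift_hom[OF comult_gens_ok, folded d4_comult_def]


section \<open>Modules\<close>

text \<open>A finite-dimensional \<open>D\<^sub>4\<close>-module with a basis indexed by the finite type \<open>'n\<close> is an algebra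
  homomorphism from \<open>D\<^sub>4\<close> to the \<open>'n \<times> 'n\<close> matrices.\<close>

definition d4_rep :: "('k::field d4 \<Rightarrow> 'k^'n^'n) \<Rightarrow> bool" where
  "d4_rep \<rho> \<longleftrightarrow> (\<forall>x y. \<rho> (x + y) = \<rho> x + \<rho> y) \<and> (\<forall>x y. \<rho> (x * y) = \<rho> x ** \<rho> y) \<and>
     (\<forall>s. \<rho> (d4_scalar s) = mat s)"

interpretation mat_alg: scalar_algebra "(**) :: 'k::field^'n^'n \<Rightarrow> 'k^'n^'n \<Rightarrow> 'k^'n^'n" mat
proof
  fix c d :: 'k and x :: "'k^'n^'n"
  show "mat (c + d) = mat c + (mat d :: 'k^'n^'n)"
    by (simp add: mat_def vec_eq_iff)
  have l: "mat c ** x = (\<chi> i j. c * x $ i $ j)" for c and x :: "'k^'n^'n"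
    by (simp add: mat_def matrix_matrix_mult_def vec_eq_iff if_distrib if_distribR cong: if_cong)
  have r: "x ** mat c = (\<chi> i j. c * x $ i $ j)"
    by (simp add: mat_def matrix_matrix_mult_def vec_eq_iff if_distrib if_distribR mult.commute
        cong: if_cong)
  show "mat (c * d) = mat c ** (mat d :: 'k^'n^'n)"
    by (simp add: l) (simp add: mat_def vec_eq_iff)
  show "mat c ** x = x ** mat c"
    by (simp add: l r)
  show "(y + z) ** x = y ** x + z ** x" for y z :: "'k^'n^'n"
    by (simp add: matrix_matrix_mult_def vec_eq_iff sum.distrib distrib_right)
qed (simp_all only: matrix_mul_assoc matrix_add_ldistrib matrix_mul_lid matrix_mul_rid)

lemma d4_lift_rep:
  assumes "d4_gens_ok (**) mat f"
  shows "d4_rep (d4_lift (**) mat f)"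
  unfolding d4_rep_def using mat_alg.d4_lift_hom[OF assms] by blast

lemma trivial_gens_ok:
  "d4_gens_ok (**) mat (\<lambda>g. mat (counit_gen g) :: 'k::field^'n^'n)"
  by (simp add: d4_gens_ok_def counit_gen_def mat_alg.sc_zero)

typedef (overloaded) ('k::field, 'n::finite) d4_module =
  "{\<rho> :: 'k d4 \<Rightarrow> 'k^'n^'n. d4_rep \<rho>}"
  using d4_lift_rep[OF trivial_gens_ok] by blast

abbreviation d4_matrix :: "('k::field, 'n::finite) d4_module \<Rightarrow> 'k d4 \<Rightarrow> 'k^'n^'n" where
  "d4_matrix \<equiv> Rep_d4_module"

lemma d4_matrix_rep: "d4_rep (d4_matrix M)"
  using Rep_d4_module by blast

definition d4_act :: "('k::field, 'n::finite) d4_module \<Rightarrow> 'k d4 \<Rightarrow> 'k^'n \<Rightarrow> 'k^'n" where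
  "d4_act M x v = d4_matrix M x *v v"

definition d4_hom ::
  "('k::field, 'n::finite) d4_module \<Rightarrow> ('k, 'm::finite) d4_module \<Rightarrow> ('k^'n \<Rightarrow> 'k^'m) \<Rightarrow> bool" where
  "d4_hom M N f \<longleftrightarrow> Vector_Spaces.linear (*s) (*s) f \<and>
     (\<forall>x v. f (d4_act M x v) = d4_act N x (f v))"

definition d4_iso :: "('k::field, 'n::finite) d4_module \<Rightarrow> ('k, 'm::finite) d4_module \<Rightarrow> bool"
    (infix "\<cong>\<^sub>D" 50) where
  "M \<cong>\<^sub>D N \<longleftrightarrow> (\<exists>f. d4_hom M N f \<and> bij f)"


lemma d4_act_simps:
  shows "d4_act M (x + y) v = d4_act M x v + d4_act M y v"
    and "d4_act M (x * y) v = d4_act M x (d4_act M y v)"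
    and "d4_act M (d4_scalar s) v = s *s v"
    and "d4_act M 1 v = v"
    and "d4_act M x (v + w) = d4_act M x v + d4_act M x w"
    and "d4_act M x (s *s v) = s *s d4_act M x v"
    and "d4_act M x 0 = 0"
    and "d4_act M x (- v) = - d4_act M x v"
proof -
  note r = d4_matrix_rep[of M, unfolded d4_rep_def]
  show s: "d4_act M (d4_scalar s) v = s *s v" for s
  proof -
    have "d4_matrix M (d4_scalar s) = mat s" using r by simp
    then show ?thesis
      by (simp add: d4_act_def) (simp add: mat_def matrix_vector_mult_def vec_eq_iff if_distrib
          if_distribR cong: if_cong)
  qed
  show "d4_act M 1 v = v"
    using s[of 1] by simp
  show "d4_act M (x + y) v = d4_act M x v + d4_act M y v"
    using r by (simp add: d4_act_def matrix_vector_mult_add_rdistrib)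
  show "d4_act M (x * y) v = d4_act M x (d4_act M y v)"
    using r by (simp add: d4_act_def matrix_vector_mul_assoc)
  show "d4_act M x (v + w) = d4_act M x v + d4_act M x w"
    by (simp add: d4_act_def matrix_vector_right_distrib)
  show "d4_act M x (s *s v) = s *s d4_act M x v"
    by (simp add: d4_act_def vector_scalar_commute)
  show "d4_act M x 0 = 0"
    by (simp add: d4_act_def)
  show "d4_act M x (- v) = - d4_act M x v"
    by (simp add: d4_act_def matrix_vector_mult_def vec_eq_iff sum_negf)
qed

lemma d4_homI:
  assumes f: "Vector_Spaces.linear (*s) (*s) f"
    and gen: "\<And>g v. f (d4_act M (d4_gen g) v) = d4_act N (d4_gen g) (f v)"
  shows "d4_hom M N f"
proof -
  interpret Vector_Spaces.linear "(*s)" "(*s)" f by (rule f)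
  have "\<forall>v. f (d4_act M x v) = d4_act N x (f v)" for x
    by (induction x rule: d4_induct) (simp_all add: d4_act_simps add scale gen)
  then show ?thesis using f by (simp add: d4_hom_def)
qed


subsection \<open>Direct sums and tensor products\<close>

definition block_diag :: "'k::zero^'n^'n \<Rightarrow> 'k^'m^'m \<Rightarrow> 'k^('n + 'm)^('n + 'm)" where
  "block_diag A B = (\<chi> i j. case (i, j) of
      (Inl i, Inl j) \<Rightarrow> A $ i $ j
    | (Inr i, Inr j) \<Rightarrow> B $ i $ j
    | _ \<Rightarrow> 0)"

lemma sum_UNIV_Plus:
  "(\<Sum>i\<in>UNIV. f (i :: 'n::finite + 'm::finite)) = (\<Sum>i\<in>UNIV. f (Inl i)) + (\<Sum>i\<in>UNIV. f (Inr i))"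
  unfolding UNIV_Plus_UNIV[symmetric] by (subst sum.Plus) simp_all

lemma block_diag_add: "block_diag (A + A') (B + B' :: 'k::ring_1^'m^'m) = block_diag A B + block_diag A' B'"
  by (auto simp: block_diag_def vec_eq_iff split: sum.splits)

lemma block_diag_mult:
  "block_diag (A ** A') (B ** B' :: 'k::ring_1^'m::finite^'m)
     = block_diag (A :: 'k^'n::finite^'n) B ** block_diag A' B'"
  by (auto simp: block_diag_def matrix_matrix_mult_def vec_eq_iff sum_UNIV_Plus split: sum.splits)

lemma block_diag_mat:
  "block_diag (mat s) (mat s :: 'k::ring_1^'m::finite^'m) = (mat s :: 'k^('n::finite + 'm)^('n + 'm))"
  by (auto simp: block_diag_def mat_def vec_eq_iff split: sum.splits)

definition d4_dsum ::
  "('k::field, 'n::finite) d4_module \<Rightarrow> ('k, 'm::finite) d4_module \<Rightarrow> ('k, 'n + 'm) d4_module"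
  (infixr "\<oplus>\<^sub>D" 65) where
  "M \<oplus>\<^sub>D N = Abs_d4_module (\<lambda>x. block_diag (d4_matrix M x) (d4_matrix N x))"

lemma d4_matrix_dsum: "d4_matrix (M \<oplus>\<^sub>D N) x = block_diag (d4_matrix M x) (d4_matrix N x)"
proof -
  have "d4_rep (\<lambda>x. block_diag (d4_matrix M x) (d4_matrix N x))"
    using d4_matrix_rep[of M] d4_matrix_rep[of N]
    by (simp add: d4_rep_def block_diag_add block_diag_mult block_diag_mat)
  then show ?thesis
    by (simp add: d4_dsum_def Abs_d4_module_inverse)
qed

text \<open>The matrix of \<open>A \<otimes> B\<close> in the basis \<open>(v\<^sub>i \<otimes> w\<^sub>j)\<close>.\<close>

definition kronecker :: "'k::times^'n^'n \<Rightarrow> 'k^'m^'m \<Rightarrow> 'k^('n \<times> 'm)^('n \<times> 'm)" where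
  "kronecker A B = (\<chi> i j. A $ fst i $ fst j * B $ snd i $ snd j)"

lemma kronecker_mult:
  "kronecker (A ** A') (B ** B' :: 'k::field^'m::finite^'m)
     = kronecker (A :: 'k^'n::finite^'n) B ** kronecker A' B'"
proof -
  have "(\<Sum>i\<in>UNIV. f i) * (\<Sum>j\<in>UNIV. g j) = (\<Sum>p\<in>UNIV. f (fst p) * g (snd p))"
    for f :: "'n \<Rightarrow> 'k" and g :: "'m \<Rightarrow> 'k"
    unfolding UNIV_Times_UNIV[symmetric]
    by (simp add: sum_product sum.cartesian_product case_prod_beta)
  then show ?thesis
    by (simp add: kronecker_def matrix_matrix_mult_def vec_eq_iff mult_ac)
qed

lemma kronecker_mat:
  "kronecker (mat s) (mat t :: 'k::field^'m::finite^'m) = (mat (s * t) :: 'k^('n::finite \<times> 'm)^('n \<times> 'm))"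
  by (auto simp: kronecker_def mat_def vec_eq_iff prod_eq_iff)

lemma kronecker_scale:
  shows "kronecker (mat s ** A) (B :: 'k::field^'m::finite^'m) = mat s ** kronecker (A :: 'k^'n::finite^'n) B"
    and "kronecker A (mat s ** B) = mat s ** kronecker A B"
proof -
  show "kronecker (mat s ** A) B = mat s ** kronecker A B"
    using kronecker_mult[of "mat s" A "mat 1" B] by (simp add: kronecker_mat)
  show "kronecker A (mat s ** B) = mat s ** kronecker A B"
    using kronecker_mult[of "mat 1" A "mat s" B] by (simp add: kronecker_mat)
qed

lemma kronecker_bilinear_hom:
  fixes \<rho> :: "'k::field d4 \<Rightarrow> 'k^'n::finite^'n" and \<sigma> :: "'k d4 \<Rightarrow> 'k^'m::finite^'m"
  assumes "d4_rep \<rho>" "d4_rep \<sigma>"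
  shows "bilinear_hom (**) mat (\<lambda>x y. kronecker (\<rho> x) (\<sigma> y))"
proof -
  have "\<rho> 1 = mat 1" "\<sigma> 1 = mat 1"
    using assms unfolding d4_rep_def by (metis d4_scalar_one)+
  then show ?thesis
    using assms unfolding d4_rep_def
    by unfold_locales
      (simp_all add: kronecker_mat kronecker_mult kronecker_scale,
       simp_all add: kronecker_def vec_eq_iff algebra_simps)
qed

text \<open>The action of \<open>D\<^sub>4 \<otimes> D\<^sub>4\<close> on \<open>M \<otimes> N\<close>, that is \<open>(x \<otimes> y) (v \<otimes> w) = x v \<otimes> y w\<close>.\<close>

definition d4_sq_matrix ::
  "('k::field, 'n::finite) d4_module \<Rightarrow> ('k, 'm::finite) d4_module \<Rightarrow> 'k d4_sq \<Rightarrow> 'k^('n \<times> 'm)^('n \<times> 'm)"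
  where
  "d4_sq_matrix M N t =
     monoid_alg_ev (**) mat (pair_ev (\<lambda>x y. kronecker (d4_matrix M x) (d4_matrix N y))) (rep_d4_sq t)"

lemma d4_sq_matrix_abs:
  "d4_sq_matrix M N (abs_d4_sq p) =
     monoid_alg_ev (**) mat (pair_ev (\<lambda>x y. kronecker (d4_matrix M x) (d4_matrix N y))) p"
proof -
  have "rep_d4_sq (abs_d4_sq p) - p \<in> ideal_gen bilinear_relations"
    unfolding d4_sq.abs_eq_iff[symmetric] by (rule Quotient3_abs_rep[OF Quotient3_d4_sq])
  then show ?thesis
    unfolding d4_sq_matrix_def
    by (rule bilinear_hom.pair_ev_cong[OF kronecker_bilinear_hom[OF d4_matrix_rep d4_matrix_rep]])
qed

lemma d4_sq_matrix_hom:
  fixes M :: "('k::field, 'n::finite) d4_module" and N :: "('k, 'm::finite) d4_module"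
  shows "d4_sq_matrix M N (x + y) = d4_sq_matrix M N x + d4_sq_matrix M N y"
    and "d4_sq_matrix M N (x * y) = d4_sq_matrix M N x ** d4_sq_matrix M N y"
    and "d4_sq_matrix M N (d4_sq_scalar s) = mat s"
    and "d4_sq_matrix M N (u \<otimes>\<^sub>D v) = kronecker (d4_matrix M u) (d4_matrix N v)"
proof -
  interpret bilinear_hom "(**)" mat "\<lambda>x y. kronecker (d4_matrix M x) (d4_matrix N y)"
    by (rule kronecker_bilinear_hom[OF d4_matrix_rep d4_matrix_rep])
  obtain p q where [simp]: "x = abs_d4_sq p" "y = abs_d4_sq q"
    by (rule that[of "rep_d4_sq x" "rep_d4_sq y"])
      (simp_all only: Quotient3_abs_rep[OF Quotient3_d4_sq])
  show "d4_sq_matrix M N (x + y) = d4_sq_matrix M N x + d4_sq_matrix M N y"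
    by (simp add: plus_d4_sq.abs_eq d4_sq_matrix_abs mat_alg.ev_add)
  show "d4_sq_matrix M N (x * y) = d4_sq_matrix M N x ** d4_sq_matrix M N y"
    by (simp add: times_d4_sq.abs_eq d4_sq_matrix_abs ev_pair_mult)
  show "d4_sq_matrix M N (d4_sq_scalar s) = mat s"
    by (simp add: d4_sq_scalar.abs_eq d4_sq_matrix_abs ev_pair_scalar)
  show "d4_sq_matrix M N (u \<otimes>\<^sub>D v) = kronecker (d4_matrix M u) (d4_matrix N v)"
    by (simp add: d4_tensor_def d4_sq_matrix_abs ev_pair_sym)
qed

definition d4_module_tensor ::
  "('k::field, 'n::finite) d4_module \<Rightarrow> ('k, 'm::finite) d4_module \<Rightarrow> ('k, 'n \<times> 'm) d4_module"
  (infixr "\<otimes>\<^sub>M" 70) where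
  "M \<otimes>\<^sub>M N = Abs_d4_module (\<lambda>x. d4_sq_matrix M N (d4_comult x))"

lemma d4_matrix_tensor: "d4_matrix (M \<otimes>\<^sub>M N) x = d4_sq_matrix M N (d4_comult x)"
proof -
  have "d4_rep (\<lambda>x. d4_sq_matrix M N (d4_comult x))"
    by (simp add: d4_rep_def d4_comult_hom d4_sq_matrix_hom)
  then show ?thesis
    by (simp add: d4_module_tensor_def Abs_d4_module_inverse)
qed

lemma d4_matrix_tensor_gen:
  "d4_matrix (M \<otimes>\<^sub>M N) (d4_gen g) = d4_sq_matrix M N (comult_gen g)"
  by (simp add: d4_matrix_tensor d4_comult_hom)


subsection \<open>The modules \<open>V(2,r)\<close> and \<open>P(r)\<close>\<close>

definition sgn2 :: "bit \<Rightarrow> 'k::field" where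
  "sgn2 r = (if r = 0 then 1 else -1)"

lemma vector_2' [simp]:
  "(vector [x, y] :: 'a::zero^2) $ 1 = x" "(vector [x, y] :: 'a::zero^2) $ 2 = y"
  by (simp_all add: vector_def)

lemma vector_4' [simp]:
  "(vector [x, y, z, w] :: 'a::zero^4) $ 1 = x" "(vector [x, y, z, w] :: 'a::zero^4) $ 2 = y"
  "(vector [x, y, z, w] :: 'a::zero^4) $ 3 = z" "(vector [x, y, z, w] :: 'a::zero^4) $ 4 = w"
  by (simp_all add: vector_def)

text \<open>The matrix \<open>transpose (vector [u\<^sub>1, \<dots>, u\<^sub>n])\<close> maps the basis vector \<open>v\<^sub>j\<close> to \<open>u\<^sub>j\<close>.\<close>

definition V2_gen :: "bit \<Rightarrow> d4_letter \<Rightarrow> 'k::field^2^2" where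
  "V2_gen r g = (let v1 = axis 1 1; v2 = axis 2 1 in
    case g of
      Ga \<Rightarrow> transpose (vector [v2, 0])
    | Gb \<Rightarrow> transpose (vector [sgn2 r *s v1, sgn2 (r + 1) *s v2])
    | Gc \<Rightarrow> transpose (vector [sgn2 (r + 1) *s v1, sgn2 r *s v2])
    | Gd \<Rightarrow> transpose (vector [0, 2 *s v1]))"

definition P_gen :: "bit \<Rightarrow> d4_letter \<Rightarrow> 'k::field^4^4" where
  "P_gen r g = (let v1 = axis 1 1; v2 = axis 2 1; v3 = axis 3 1; v4 = axis 4 1;
      bc = transpose (vector [sgn2 r *s v1, sgn2 (r + 1) *s v2, sgn2 (r + 1) *s v3, sgn2 r *s v4]) in
    case g of
      Ga \<Rightarrow> transpose (vector [v2, 0, v4, 0])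
    | Gb \<Rightarrow> bc
    | Gc \<Rightarrow> bc
    | Gd \<Rightarrow> transpose (vector [v3, - v4, 0, 0]))"

lemma V2_gens_ok: "d4_gens_ok (**) mat (V2_gen r :: _ \<Rightarrow> 'k::field^2^2)"
  by (cases r)
    (simp_all add: d4_gens_ok_def V2_gen_def sgn2_def mat_def matrix_matrix_mult_def vec_eq_iff
      forall_2 sum_2 transpose_def axis_def Let_def)

lemma P_gens_ok: "d4_gens_ok (**) mat (P_gen r :: _ \<Rightarrow> 'k::field^4^4)"
  by (cases r)
    (simp_all add: d4_gens_ok_def P_gen_def sgn2_def mat_def matrix_matrix_mult_def vec_eq_iff
      forall_4 sum_4 transpose_def axis_def Let_def)

definition V2mod :: "bit \<Rightarrow> ('k::field, 2) d4_module" where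
  "V2mod r = Abs_d4_module (d4_lift (**) mat (V2_gen r))"

definition Pmod :: "bit \<Rightarrow> ('k::field, 4) d4_module" where
  "Pmod r = Abs_d4_module (d4_lift (**) mat (P_gen r))"

lemma d4_matrix_V2: "d4_matrix (V2mod r) (d4_gen g) = V2_gen r g"
  by (simp add: V2mod_def Abs_d4_module_inverse d4_lift_rep[OF V2_gens_ok]
      mat_alg.d4_lift_hom[OF V2_gens_ok])

lemma d4_matrix_P: "d4_matrix (Pmod r) (d4_gen g) = P_gen r g"
  by (simp add: Pmod_def Abs_d4_module_inverse d4_lift_rep[OF P_gens_ok]
      mat_alg.d4_lift_hom[OF P_gens_ok])

lemma V2_action:
  defines "v1 \<equiv> axis 1 1 :: 'k::field^2" and "v2 \<equiv> axis 2 1 :: 'k^2"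
  shows "d4_act (V2mod r) d4_a v1 = v2" "d4_act (V2mod r) d4_d v1 = 0"
    "d4_act (V2mod r) d4_b v1 = sgn2 r *s v1" "d4_act (V2mod r) d4_c v1 = sgn2 (r + 1) *s v1"
    "d4_act (V2mod r) d4_a v2 = 0" "d4_act (V2mod r) d4_d v2 = 2 *s v1"
    "d4_act (V2mod r) d4_b v2 = sgn2 (r + 1) *s v2" "d4_act (V2mod r) d4_c v2 = sgn2 r *s v2"
  unfolding v1_def v2_def
  by (simp_all add: d4_act_def d4_matrix_V2 V2_gen_def matrix_vector_mult_def vec_eq_iff
      forall_2 sum_2 transpose_def axis_def Let_def)

lemma P_action:
  defines "v1 \<equiv> axis 1 1 :: 'k::field^4" and "v2 \<equiv> axis 2 1 :: 'k^4"
    and "v3 \<equiv> axis 3 1 :: 'k^4" and "v4 \<equiv> axis 4 1 :: 'k^4"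
  shows "d4_act (Pmod r) d4_a v1 = v2" "d4_act (Pmod r) d4_d v1 = v3"
    "d4_act (Pmod r) d4_a v2 = 0" "d4_act (Pmod r) d4_d v2 = - v4"
    "d4_act (Pmod r) d4_a v3 = v4" "d4_act (Pmod r) d4_d v3 = 0"
    "d4_act (Pmod r) d4_a v4 = 0" "d4_act (Pmod r) d4_d v4 = 0"
    "d4_act (Pmod r) d4_b v1 = sgn2 r *s v1" "d4_act (Pmod r) d4_c v1 = sgn2 r *s v1"
    "d4_act (Pmod r) d4_b v2 = sgn2 (r + 1) *s v2" "d4_act (Pmod r) d4_c v2 = sgn2 (r + 1) *s v2"
    "d4_act (Pmod r) d4_b v3 = sgn2 (r + 1) *s v3" "d4_act (Pmod r) d4_c v3 = sgn2 (r + 1) *s v3"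
    "d4_act (Pmod r) d4_b v4 = sgn2 r *s v4" "d4_act (Pmod r) d4_c v4 = sgn2 r *s v4"
  unfolding v1_def v2_def v3_def v4_def
  by (simp_all add: d4_act_def d4_matrix_P P_gen_def matrix_vector_mult_def vec_eq_iff
      forall_4 sum_4 transpose_def axis_def Let_def)


text \<open>The module \<open>Pmod r\<close> is the projective cover of the one-dimensional module \<open>V1mod r\<close>: it is
  projective and the projection to \<open>V1mod r\<close> is an essential epimorphism.  Projectivity quantifies
  over modules of arbitrary dimension and is therefore not a predicate but a polymorphic lemma.\<close>

definition V1_gen :: "bit \<Rightarrow> d4_letter \<Rightarrow> 'k::field^1^1" where
  "V1_gen r g = (case g of Ga \<Rightarrow> 0 | Gb \<Rightarrow> mat (sgn2 r) | Gc \<Rightarrow> mat (sgn2 r) | Gd \<Rightarrow> 0)"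

lemma V1_gens_ok: "d4_gens_ok (**) mat (V1_gen r :: _ \<Rightarrow> 'k::field^1^1)"
  by (cases r)
    (simp_all add: d4_gens_ok_def V1_gen_def sgn2_def mat_def matrix_matrix_mult_def vec_eq_iff)

definition V1mod :: "bit \<Rightarrow> ('k::field, 1) d4_module" where
  "V1mod r = Abs_d4_module (d4_lift (**) mat (V1_gen r))"

lemma d4_matrix_V1: "d4_matrix (V1mod r) (d4_gen g) = V1_gen r g"
  by (simp add: V1mod_def Abs_d4_module_inverse d4_lift_rep[OF V1_gens_ok]
      mat_alg.d4_lift_hom[OF V1_gens_ok])

lemma P_action_coords:
  fixes v :: "'k::field^4"
  shows "d4_act (Pmod r) d4_a v = vector [0, v $ 1, 0, v $ 3]"
    and "d4_act (Pmod r) d4_d v = vector [0, 0, v $ 1, - v $ 2]"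
    and "d4_act (Pmod r) d4_b v = vector [sgn2 r * v $ 1, - sgn2 r * v $ 2, - sgn2 r * v $ 3, sgn2 r * v $ 4]"
    and "d4_act (Pmod r) d4_c v = vector [sgn2 r * v $ 1, - sgn2 r * v $ 2, - sgn2 r * v $ 3, sgn2 r * v $ 4]"
  by (cases r; simp add: d4_act_def d4_matrix_P P_gen_def matrix_vector_mult_def vec_eq_iff sgn2_def
      forall_4 sum_4 transpose_def axis_def Let_def)+

lemma P_projective:
  fixes M :: "('k::field, 'n::finite) d4_module" and N :: "('k, 'm::finite) d4_module"
  assumes char: "CHAR('k) \<noteq> 2"
    and g: "d4_hom M N g" "surj g" and f: "d4_hom (Pmod r) N f"
  shows "\<exists>h. d4_hom (Pmod r) M h \<and> f = g \<circ> h"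
proof -
  have two: "(2::'k) \<noteq> 0"
  proof
    assume "(2::'k) = 0"
    then have "CHAR('k) dvd 2"
      using of_nat_eq_0_iff_char_dvd[of 2, where ?'a='k] by simp
    then have "CHAR('k) \<le> 2" "CHAR('k) \<noteq> 0"
      by (auto dest: dvd_imp_le intro!: Nat.gr0I)
    then show False using char CHAR_not_1'[where ?'a='k] by linarith
  qed
  interpret gl: Vector_Spaces.linear "(*s)" "(*s)" g using g by (simp add: d4_hom_def)
  interpret fl: Vector_Spaces.linear "(*s)" "(*s)" f using f by (simp add: d4_hom_def)
  have gh: "g (d4_act M x v) = d4_act N x (g v)" for x v using g by (simp add: d4_hom_def)
  have fh: "f (d4_act (Pmod r) x v) = d4_act N x (f v)" for x v using f by (simp add: d4_hom_def)
  define s :: 'k where "s = sgn2 r"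
  have ss: "s * s = 1" by (simp add: s_def sgn2_def)
  obtain m where m: "g m = f (axis 1 1)" using g(2) by (metis surjD)
  note rel = d4_relations_hold[where 'k='k, unfolded power2_eq_square]
  define A B C D where "A = d4_act M d4_a" and "B = d4_act M d4_b"
    and "C = d4_act M d4_c" and "D = d4_act M d4_d"
  note defs = A_def B_def C_def D_def
  have lin: "X (v + w) = X v + X w" "X (t *s v) = t *s X v" "X 0 = 0" "X (- v) = - X v"
    "X (v - w) = X v - X w"
    if mem: "X \<in> {A, B, C, D}" for X v w t
  proof -
    obtain x where X: "X = d4_act M x" using mem unfolding defs by blast
    show "X (v + w) = X v + X w" "X (t *s v) = t *s X v" "X 0 = 0" "X (- v) = - X v"
      by (simp_all add: X d4_act_simps)
    show "X (v - w) = X v - X w"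
      by (metis X d4_act_simps(5,8) diff_conv_add_uminus)
  qed
  have op: "d4_act M (x * y) v = d4_act M x (d4_act M y v)" for x y v
    by (rule d4_act_simps)
  have BB: "B (B v) = v" and CC: "C (C v) = v" and AA: "A (A v) = 0" and DD: "D (D v) = 0"
    and BC: "B (C v) = C (B v)" and BA: "B (A v) = - A (B v)" and CA: "C (A v) = - A (C v)"
    and DB: "B (D v) = - D (B v)" and DC: "C (D v) = - D (C v)"
    and DA: "D (A v) = v - C (B v) - A (D v)" for v
  proof -
    have neg: "d4_act M (- x) v = - d4_act M x v" and z: "d4_act M 0 v = 0" for x v
      using d4_act_simps(1)[of M x "- x" v] d4_act_simps(3)[of M 0 v]
      by (simp_all add: d4_alg.sc_zero eq_neg_iff_add_eq_0 add.commute)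
    show "B (B v) = v" "C (C v) = v" "A (A v) = 0" "D (D v) = 0"
      by (simp_all add: defs rel z d4_act_simps(4) flip: op)
    show bc: "B (C v) = C (B v)" and "B (A v) = - A (B v)" "C (A v) = - A (C v)"
      by (simp_all add: defs rel neg flip: op)
    show "B (D v) = - D (B v)" "C (D v) = - D (C v)"
      by (simp_all add: defs rel neg flip: op)
    have "d4_act M (d4_d * d4_a + d4_a * d4_d + d4_b * d4_c) v = v"
      unfolding rel by (simp add: d4_act_simps(4))
    then have "D (A v) + A (D v) + B (C v) = v"
      by (simp add: d4_act_simps(1,2) defs)
    then show "D (A v) = v - C (B v) - A (D v)"
      by (simp add: bc algebra_simps)
  qed
  define u where "u = m + s *s B m"
  define w where "w = u + s *s C u"
  define e where "e = (1 / 4) *s w"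
  have Bu: "B u = s *s u"
    by (simp add: u_def lin BB ss vector_add_ldistrib vector_smult_assoc)
  have "C w = s *s w" "B w = s *s w"
    by (simp_all add: w_def lin CC BC Bu ss vector_add_ldistrib vector_smult_assoc)
  then have Be: "B e = s *s e" and Ce: "C e = s *s e"
    by (simp_all add: e_def lin vector_smult_assoc mult.commute)
  have 1: "d4_act N d4_b (g m) = s *s g m" "d4_act N d4_c (g m) = s *s g m"
    by (simp_all add: m P_action s_def fl.scale flip: fh)
  have gu: "g u = 2 *s g m"
    by (simp add: u_def gl.add gl.scale gh B_def 1 vector_smult_assoc ss)
      (simp add: vec_eq_iff)
  have "g w = 4 *s g m"
    by (simp add: w_def gl.add gl.scale gh C_def gu 1 d4_act_simps vector_smult_assoc
        mult.left_commute[of s] ss) (simp add: vec_eq_iff)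
  moreover have "(4::'k) \<noteq> 0"
  proof -
    have "(4::'k) = 2 * 2" by simp
    then show ?thesis using two by (metis mult_eq_0_iff)
  qed
  ultimately have ge: "g e = f (axis 1 1)"
    by (simp add: e_def gl.scale vector_smult_assoc m)
  define h where "h v = v $ 1 *s e + v $ 2 *s A e + v $ 3 *s D e + v $ 4 *s A (D e)" for v :: "'k^4"
  have "d4_hom (Pmod r) M h"
  proof (rule d4_homI)
    show "Vector_Spaces.linear (*s) (*s) h"
      by (unfold_locales) (simp_all add: h_def vec_eq_iff algebra_simps)
    fix x v
    note l = h_def P_action_coords lin AA DD BA CA DB DC DA Be Ce ss vector_smult_assoc
    show "h (d4_act (Pmod r) (d4_gen x) v) = d4_act M (d4_gen x) (h v)"
    proof (cases x)
      case Ga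
      have "h (d4_act (Pmod r) d4_a v) = A (h v)" by (simp add: l)
      then show ?thesis by (simp add: Ga A_def)
    next
      case Gb
      have "h (d4_act (Pmod r) d4_b v) = B (h v)"
        by (simp add: l flip: s_def) (simp add: vec_eq_iff algebra_simps)
      then show ?thesis by (simp add: Gb B_def)
    next
      case Gc
      have "h (d4_act (Pmod r) d4_c v) = C (h v)"
        by (simp add: l flip: s_def) (simp add: vec_eq_iff algebra_simps)
      then show ?thesis by (simp add: Gc C_def)
    next
      case Gd
      have "h (d4_act (Pmod r) d4_d v) = D (h v)"
        by (simp add: l)
      then show ?thesis by (simp add: Gd D_def)
    qed
  qed
  moreover have "f v = g (h v)" for v
  proof -
    have v: "v = v $ 1 *s axis 1 1 + v $ 2 *s axis 2 1 + v $ 3 *s axis 3 1 + v $ 4 *s axis 4 1"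
      by (simp add: vec_eq_iff forall_4 axis_def)
    have ax: "f (axis 2 1) = g (A e)" "f (axis 3 1) = g (D e)" "f (axis 4 1) = g (A (D e))"
      unfolding A_def D_def gh ge by (simp_all flip: fh add: P_action)
    show ?thesis
      by (subst v) (simp add: h_def fl.add fl.scale gl.add gl.scale ax ge)
  qed
  ultimately show ?thesis by (intro exI[of _ h]) auto
qed

lemma P_essential:
  fixes M :: "('k::field, 'n::finite) d4_module" and r :: bit
  defines "p \<equiv> (\<lambda>v. \<chi> i. v $ 1) :: 'k^4 \<Rightarrow> 'k^1"
  shows "d4_hom (Pmod r) (V1mod r) p" and "surj p"
    and "d4_hom M (Pmod r) f \<Longrightarrow> surj (p \<circ> f) \<Longrightarrow> surj f"
proof -
  show "d4_hom (Pmod r) (V1mod r) p"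
  proof (rule d4_homI)
    show "Vector_Spaces.linear (*s) (*s) p"
      by unfold_locales (simp_all add: p_def vec_eq_iff algebra_simps)
    show "p (d4_act (Pmod r) (d4_gen x) v) = d4_act (V1mod r) (d4_gen x) (p v)" for x v
      by (cases x)
        (simp_all add: p_def P_action_coords d4_act_def[of "V1mod r"] d4_matrix_V1 V1_gen_def
          vec_eq_iff matrix_vector_mult_def mat_def)
  qed
  show "surj p"
  proof (rule surjI)
    show "p (\<chi> i. y $ 1) = y" for y
      by (simp add: p_def vec_eq_iff)
  qed
  assume f: "d4_hom M (Pmod r) f" and sf: "surj (p \<circ> f)"
  interpret fl: Vector_Spaces.linear "(*s)" "(*s)" f using f by (simp add: d4_hom_def)
  have fh: "f (d4_act M x v) = d4_act (Pmod r) x (f v)" for x v using f by (simp add: d4_hom_def)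
  obtain m where m: "p (f m) = (\<chi> i. 1)" using sf by (metis comp_apply surjD)
  define u where "u = f m"
  have u1: "u $ 1 = 1" using m by (simp add: p_def u_def vec_eq_iff)
  have u: "u \<in> range f" by (simp add: u_def)
  have act: "d4_act (Pmod r) x v \<in> range f" if "v \<in> range f" for x v
    using that by (auto simp flip: fh)
  have add: "v + w \<in> range f" if "v \<in> range f" "w \<in> range f" for v w
    using that by (auto simp flip: fl.add)
  have sc: "s *s v \<in> range f" if "v \<in> range f" for s v
    using that by (auto simp flip: fl.scale)
  have v4: "axis 4 1 \<in> range f"
  proof -
    have "d4_act (Pmod r) d4_a (d4_act (Pmod r) d4_d u) = axis 4 1"
      by (simp add: P_action_coords vec_eq_iff forall_4 axis_def u1)
    then show ?thesis using act u by metis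
  qed
  have v2: "axis 2 1 \<in> range f"
  proof -
    have "d4_act (Pmod r) d4_a u + (- (u $ 3)) *s axis 4 1 = axis 2 1"
      by (simp add: P_action_coords vec_eq_iff forall_4 axis_def u1)
    then show ?thesis using act u v4 add sc by metis
  qed
  have v3: "axis 3 1 \<in> range f"
  proof -
    have "d4_act (Pmod r) d4_d u + u $ 2 *s axis 4 1 = axis 3 1"
      by (simp add: P_action_coords vec_eq_iff forall_4 axis_def u1)
    then show ?thesis using act u v4 add sc by metis
  qed
  have "v \<in> range f" for v
  proof -
    have "v = v $ 1 *s u + (v $ 2 - v $ 1 * u $ 2) *s axis 2 1
        + (v $ 3 - v $ 1 * u $ 3) *s axis 3 1 + (v $ 4 - v $ 1 * u $ 4) *s axis 4 1"
      by (simp add: vec_eq_iff forall_4 axis_def u1)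
    then show ?thesis using add sc u v2 v3 v4 by metis
  qed
  then show "surj f" by blast
qed

end

theory Submission
  imports Defs
begin

text \<open>
  On \<open>W = V(2,r') \<otimes> P(r)\<close> the element \<open>bc\<close> acts as \<open>-1\<close>, so \<open>da + ad = 2\<close> there, and every
  \<open>b\<close>-eigenvector \<open>u\<close> with \<open>d u = 0\<close> generates a copy of some \<open>V(2,q)\<close> with basis \<open>u, a u\<close>.
  The kernel of \<open>d\<close> on \<open>W\<close> consists of the vectors \<open>u(x) = v\<^sub>1 \<otimes> x - v\<^sub>2 \<otimes> (cdx)/2\<close>
  for \<open>x \<in> P(r)\<close>, and \<open>W\<close> is the direct sum of \<open>ker d\<close> and \<open>a (ker d)\<close>.  Writing
  \<open>v\<^sub>1 \<otimes> p + v\<^sub>2 \<otimes> q = u(x) + a u(y)\<close> gives \<open>y = dp/2 + cq\<close> and \<open>x = p - ay\<close>; the four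
  coordinate pairs \<open>(x\<^sub>j, y\<^sub>j)\<close> are the projections to the four summands.
\<close>

lemma two_neq_zero_if_CHAR_neq_2:
  assumes "CHAR('k::field) \<noteq> 2"
  shows "(2::'k) \<noteq> 0"
proof
  assume "(2::'k) = 0"
  then have "CHAR('k) dvd 2"
    using of_nat_eq_0_iff_char_dvd[of 2, where ?'a='k] by simp
  then have "CHAR('k) = 1"
    using assms prime_nat_iff two_is_prime_nat by blast
  then show False
    using CHAR_not_1'[where ?'a='k] by simp
qed

lemma d4_act_dsum:
  shows "d4_act (M \<oplus>\<^sub>D N) x v $ Inl i = d4_act M x (\<chi> i. v $ Inl i) $ i"
    and "d4_act (M \<oplus>\<^sub>D N) x v $ Inr j = d4_act N x (\<chi> j. v $ Inr j) $ j"
  by (simp_all add: d4_act_def d4_matrix_dsum block_diag_def matrix_vector_mult_def sum_UNIV_Plus)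

text \<open>Acting by \<open>B\<close> on the second index and then by \<open>A\<close> on the first
  lets the coordinate formulas of the two factors be reused.\<close>

lemma kronecker_mult_vec:
  fixes A :: "'k::field^'n::finite^'n" and B :: "'k^'m::finite^'m"
  shows "(kronecker A B *v v) $ (i, j) = (A *v (\<chi> i'. (B *v (\<chi> j'. v $ (i', j'))) $ j)) $ i"
  unfolding matrix_vector_mult_def kronecker_def UNIV_Times_UNIV[symmetric]
  by (simp add: sum_distrib_left sum.cartesian_product case_prod_beta mult_ac)

lemma V2_action_coords:
  fixes v :: "'k::field^2"
  shows "d4_act (V2mod r) d4_a v = vector [0, v $ 1]"
    and "d4_act (V2mod r) d4_d v = vector [2 * v $ 2, 0]"
    and "d4_act (V2mod r) d4_b v = vector [sgn2 r * v $ 1, - sgn2 r * v $ 2]"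
    and "d4_act (V2mod r) d4_c v = vector [- sgn2 r * v $ 1, sgn2 r * v $ 2]"
  by (cases r; simp add: d4_act_def d4_matrix_V2 V2_gen_def matrix_vector_mult_def vec_eq_iff sgn2_def
      forall_2 sum_2 transpose_def axis_def Let_def)+

lemma d4_act_tensor:
  fixes M :: "('k::field, 'n::finite) d4_module" and N :: "('k, 'm::finite) d4_module"
    and v :: "'k^('n \<times> 'm)"
  defines "T x y i j \<equiv> d4_act M x (\<chi> i'. d4_act N y (\<chi> j'. v $ (i', j')) $ j) $ i"
  shows "d4_act (M \<otimes>\<^sub>M N) d4_a v $ (i, j) = T d4_a d4_b i j + T 1 d4_a i j"
    and "d4_act (M \<otimes>\<^sub>M N) d4_b v $ (i, j) = T d4_b d4_b i j"
    and "d4_act (M \<otimes>\<^sub>M N) d4_c v $ (i, j) = T d4_c d4_c i j"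
    and "d4_act (M \<otimes>\<^sub>M N) d4_d v $ (i, j) = T d4_d d4_c i j + T 1 d4_d i j"
  unfolding T_def
  by (simp_all add: d4_act_def d4_matrix_tensor_gen comult_gen_def d4_sq_matrix_hom
      matrix_vector_mult_add_rdistrib kronecker_mult_vec)

text \<open>The two rows are \<open>p\<close> and \<open>q\<close> in v1 \<otimes> p + v2 \<otimes>
  q. The sign for \<open>c\<close> arises because \<open>b\<close> and \<open>c\<close> agree on
  \<open>Pmod r\<close> but are opposite on \<open>V2mod r'\<close>.\<close>

lemma V2_tensor_P_action_coords:
  fixes v :: "'k::field^(2 \<times> 4)" and r r' :: bit
  defines "W \<equiv> (V2mod r' :: ('k, 2) d4_module) \<otimes>\<^sub>M (Pmod r :: ('k, 4) d4_module)"
    and "s \<equiv> sgn2 r'" and "t \<equiv> sgn2 r"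
  shows "d4_act W d4_a v = (\<chi> p. (vector [vector [0, v $ (1,1), 0, v $ (1,3)],
      vector [t * v $ (1,1), v $ (2,1) - t * v $ (1,2), - t * v $ (1,3), v $ (2,3) + t * v $ (1,4)]]
      :: 'k^4^2) $ fst p $ snd p)"
    and "d4_act W d4_b v = (\<chi> p. (vector [
      vector [s * t * v $ (1,1), - (s * t * v $ (1,2)), - (s * t * v $ (1,3)), s * t * v $ (1,4)],
      vector [- (s * t * v $ (2,1)), s * t * v $ (2,2), s * t * v $ (2,3), - (s * t * v $ (2,4))]]
      :: 'k^4^2) $ fst p $ snd p)"
    and "d4_act W d4_c v = - d4_act W d4_b v"
    and "d4_act W d4_d v = (\<chi> p. (vector [
      vector [2 * t * v $ (2,1), - 2 * t * v $ (2,2), v $ (1,1) - 2 * t * v $ (2,3),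
        2 * t * v $ (2,4) - v $ (1,2)],
      vector [0, 0, v $ (2,1), - v $ (2,2)]] :: 'k^4^2) $ fst p $ snd p)"
  unfolding W_def s_def t_def
  by (simp_all add: vec_eq_iff d4_act_tensor d4_act_simps(4) V2_action_coords P_action_coords
      forall_2 forall_4 algebra_simps)

theorem corollary2p8:
  fixes r r' :: bit
  assumes "CHAR('k::alg_closed_field) \<noteq> 2"
  shows "(V2mod r' :: ('k, 2) d4_module) \<otimes>\<^sub>M (Pmod r :: ('k, 4) d4_module)
    \<cong>\<^sub>D (V2mod 0 \<oplus>\<^sub>D V2mod 0) \<oplus>\<^sub>D (V2mod 1 \<oplus>\<^sub>D V2mod 1)"
proof -
  let ?W = "(V2mod r' :: ('k, 2) d4_module) \<otimes>\<^sub>M (Pmod r :: ('k, 4) d4_module)"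
  let ?S = "((V2mod 0 :: ('k, 2) d4_module) \<oplus>\<^sub>D V2mod 0) \<oplus>\<^sub>D (V2mod 1 \<oplus>\<^sub>D V2mod 1)"
  note two = two_neq_zero_if_CHAR_neq_2[OF assms]
  then have four: "(4::'k) \<noteq> 0"
    by (metis mult_2 mult_eq_0_iff numeral_Bit0)
  define t :: 'k where "t = sgn2 r"
  have tt: "t * t = 1" "t * (t * z) = z" for z
    by (simp_all add: t_def sgn2_def)
  \<comment> \<open>\<open>b\<close> acts on \<open>u(p\<^sub>j)\<close> as \<open>(-1)\<^bsup>r+r'\<^esup>\<close> for \<open>j \<in> {1, 4}\<close> and with the opposite sign for
    \<open>j \<in> {2, 3}\<close>.\<close>
  define I :: "(2 + 2) + (2 + 2) \<Rightarrow> 4 \<times> 2" where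
    "I k = (case k of
        Inl (Inl i) \<Rightarrow> (if r = r' then 1 else 2, i)
      | Inl (Inr i) \<Rightarrow> (if r = r' then 4 else 3, i)
      | Inr (Inl i) \<Rightarrow> (if r = r' then 2 else 1, i)
      | Inr (Inr i) \<Rightarrow> (if r = r' then 3 else 4, i))" for k
  define J :: "4 \<times> 2 \<Rightarrow> (2 + 2) + (2 + 2)" where
    "J = (\<lambda>(j, i). (if (j = 1 \<or> j = 4) = (r = r') then Inl else Inr)
        ((if j = 1 \<or> j = 2 then Inl else Inr) i))"
  have IJ: "I (J p) = p" for p
    using exhaust_4[of "fst p"] by (cases p) (auto simp: I_def J_def)
  have JI: "J (I k) = k" for k
    by (auto simp: I_def J_def split: sum.split)
  define y :: "'k^(2 \<times> 4) \<Rightarrow> 'k^4" where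
    "y v = vector [t * v $ (2,1), - t * v $ (2,2), v $ (1,1) / 2 - t * v $ (2,3),
      t * v $ (2,4) - v $ (1,2) / 2]" for v
  define x :: "'k^(2 \<times> 4) \<Rightarrow> 'k^4" where
    "x v = vector [v $ (1,1), v $ (1,2) - y v $ 1, v $ (1,3), v $ (1,4) - y v $ 3]" for v
  define f :: "'k^(2 \<times> 4) \<Rightarrow> 'k^((2 + 2) + (2 + 2))" where
    "f v = (\<chi> k. (vector [x v $ fst (I k), y v $ fst (I k)] :: 'k^2) $ snd (I k))" for v
  \<comment> \<open>The inverse solves for p = x + ay and, since \<open>c\<close> squares to 1, q =
    c(y - dp/2).\<close>
  define h :: "'k^((2 + 2) + (2 + 2)) \<Rightarrow> 'k^(2 \<times> 4)" where
    "h w = (let X = (\<lambda>j. w $ J (j, 1)); Y = (\<lambda>j. w $ J (j, 2)) in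
      \<chi> p. (vector [vector [X 1, X 2 + Y 1, X 3, X 4 + Y 3],
        vector [t * Y 1, - t * Y 2, t * (X 1 / 2 - Y 3), t * (Y 4 + (X 2 + Y 1) / 2)]]
        :: 'k^4^2) $ fst p $ snd p)" for w
  have "d4_hom ?W ?S f"
  proof (rule d4_homI)
    show "Vector_Spaces.linear (*s) (*s) f"
      by unfold_locales
        (simp_all add: vec_eq_iff f_def x_def y_def I_def forall_2 forall_4
          algebra_simps add_divide_distrib split: sum.split)
    \<comment> \<open>In terms of x and y, \<open>a\<close> sends (x, y) to (0, x) and
      \<open>d\<close> sends it to (2y, 0), as on each \<open>V2mod\<close>. Fixing \<open>r\<close>
      and \<open>r'\<close> settles the signs and the order of the summands.\<close>
    show "f (d4_act ?W (d4_gen g) v) = d4_act ?S (d4_gen g) (f v)" for g v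
      by (cases g; cases r; cases r')
        (simp_all add: vec_eq_iff split_sum_all d4_act_dsum V2_tensor_P_action_coords V2_action_coords
          f_def x_def y_def I_def t_def sgn2_def forall_2 algebra_simps diff_divide_distrib
          add_divide_distrib two)
  qed
  moreover have "bij f"
  proof (rule o_bij)
    show "h \<circ> f = id"
      by (simp add: fun_eq_iff h_def f_def IJ vec_eq_iff forall_2 forall_4 x_def y_def tt
          algebra_simps two)
    show "f \<circ> h = id"
    proof
      fix w
      have x: "x (h w) $ j = w $ J (j, 1)" and y: "y (h w) $ j = w $ J (j, 2)" for j
        using exhaust_4[of j] by (auto simp: x_def y_def h_def tt two four Let_def field_simps)
      have "f (h w) $ k = w $ k" for k
        using exhaust_2[of "snd (I k)"] JI[of k] x y by (cases "I k") (auto simp: f_def)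
      then show "(f \<circ> h) w = id w"
        by (simp add: vec_eq_iff)
    qed
  qed
  ultimately show ?thesis
    unfolding d4_iso_def by blast
qed

end
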